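(* Let $V$ be an absolute matrix order unit space satisfying the following condition (T): for all $l,m,n\in\mathbb{N}$, if $u \in \mathcal{PI}_{m,n}(V)$ and $v \in \mathcal{PI}_{l,n}(V)$ with $\vert u \vert_{m,n} = \vert v \vert_{l,n}$, then there exists $w \in \mathcal{PI}_{m,l}(V)$ such that $\vert w^* \vert_{l,m} = \vert u^* \vert_{n,m}$ and $\vert w \vert_{m,l} = \vert v^* \vert_{n,l}$. Then partial isometric equivalence $\sim$ is an equivalence relation on $\mathcal{OP}_\infty(V)$.
   Context: A real ordered vector space $(E,E^+)$ is a real vector space with a cone $E^+$ (closed under addition and multiplication by nonnegative scalars); $u \le v$ means $v-u \in E^+$. It is an absolutely ordered space if there is a map $\vert\cdot\vert : E \to E^+$ such that: (1) $\vert v\vert = v$ if $v \in E^+$; (2) $\vert v \vert \pm v \in E^+$ for all $v$; (3) $\vert kv\vert = \vert k\vert \vert v\vert$ for $k \in \mathbb{R}$; (4) if $\vert u-v\vert = u+v$ and $0 \le w \le v$, then $\vert u-w\vert = u+w$; (5) if $\vert u-v\vert = u+v$ and $\vert u-w\vert = u+w$, then $\vert u - \vert v\pm w\vert\vert = u + \vert v \pm w\vert$. For $u,v\in E^+$, $u\perp v$ means $\vert u-v\vert=u+v$. For a $*$-vector space $V$ (complex vector space with conjugate-linear involution), $M_{m,n}(V)$ is the space of $m\times n$ matrices over $V$, $M_{m,n}=M_{m,n}(\mathbb{C})$ with the operator norm, $M_n(V)=M_{n,n}(V)$, $[v_{ij}]^*=[v_{ji}^*]$, $M_n(V)_{sa}$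 is the set of self-adjoint elements, and $v\oplus w=\begin{bmatrix} v&0\\0&w\end{bmatrix}$. A matrix ordered space is a $*$-vector space $V$ with cones $M_n(V)^+\subset M_n(V)_{sa}$ ($n\in\mathbb{N}$) such that each $(M_n(V)_{sa},M_n(V)^+)$ is a real ordered vector space and $\alpha^*v\alpha\in M_m(V)^+$ for all $v\in M_n(V)^+$, $\alpha\in M_{n,m}$; write $V^+=M_1(V)^+$. An absolutely matrix ordered space is a matrix ordered space with maps $\vert\cdot\vert_{m,n}:M_{m,n}(V)\to M_n(V)^+$ (write $\vert\cdot\vert_n=\vert\cdot\vert_{n,n}$) such that: (i) each $(M_n(V)_{sa},M_n(V)^+,\vert\cdot\vert_n)$ is an absolutely ordered space; (ii) $\vert\alpha v\beta\vert_{r,s}\le\|\alpha\|\,\vert\,\vert v\vert_{m,n}\beta\vert_{n,s}$ for $v\in M_{m,n}(V)$, $\alpha\in M_{r,m}$, $\beta\in M_{n,s}$; (iii) $\vert v\oplus w\vert_{m+r,n+s}=\vert v\vert_{m,n}\oplus\vert w\vert_{r,s}$ for $v\in M_{m,n}(V)$, $w\in M_{r,s}(V)$. A matrix order unit space $(V,e)$ is a matrix ordered space with an order unit $e\in V^+$ (for each $v\in V_{sa}$ there is $k>0$ with $ke\pm v\in V^+$) such that $V^+\cap(-V^+)=\{0\}$ and each $M_n(V)^+$ is Archimedean (if $u,v\in M_n(V)_{sa}$ and $v+ku\in M_n(V)^+$ for all $k>0$ then $v\in M_n(V)^+$). Put $e^n=e\oplus\cdots\oplus e\in M_n(V)$;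 the norm on $M_n(V)$ is $\|v\|_n=\inf\{k>0:\begin{bmatrix}ke^n&v\\ v^*&ke^n\end{bmatrix}\in M_{2n}(V)^+\}$. For $u,v\in M_n(V)_{sa}$, $u\perp_\infty v$ means $\|u+kv\|_n=\max\{\|u\|_n,\|kv\|_n\}$ for all $k\in\mathbb{R}$. For $u,v\in M_n(V)^+$, $u\perp_\infty^a v$ means $u_1\perp_\infty v_1$ whenever $0\le u_1\le u$ and $0\le v_1\le v$. An absolute matrix order unit space is a matrix order unit space that is an absolutely matrix ordered space and in which $\perp=\perp_\infty^a$ on $M_n(V)^+$ for all $n$. An order projection in $M_n(V)$ is $p=p^*\in M_n(V)$ with $\vert 2p-e^n\vert_n=e^n$; $\mathcal{OP}_n(V)$ is the set of these, and $\mathcal{OP}_\infty(V)=\{p: p\in\mathcal{OP}_n(V)\text{ for some }n\in\mathbb{N}\}$. $v\in M_{m,n}(V)$ is a partial isometry if $\vert v\vert_{m,n}\in\mathcal{OP}_n(V)$ and $\vert v^*\vert_{n,m}\in\mathcal{OP}_m(V)$; $\mathcal{PI}_{m,n}(V)$ is the set of these. For $p\in\mathcal{OP}_m(V)$, $q\in\mathcal{OP}_n(V)$, $p\sim q$ (partial isometric equivalence) means there is $v\in\mathcal{PI}_{m,n}(V)$ with $p=\vert v^*\vert_{n,m}$ and $q=\vert v\vert_{m,n}$. *)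

theory Defs
  imports
    "Jordan_Normal_Form.Schur_Decomposition"
    "HOL-Analysis.L2_Norm"
begin

section \<open>Real ordered and absolutely ordered vector spaces\<close>

text \<open>The spaces of self-adjoint matrices are subsets of the type of matrices of all sizes, and the
  zero of such a space depends on the size. Real vector spaces are therefore described with an
  explicit carrier \<open>E\<close>, zero \<open>z\<close> and scalar multiplication \<open>sc\<close>.\<close>

locale real_vector_space_on =
  fixes E :: "'b::{plus,minus} set" and z :: 'b and sc :: "real \<Rightarrow> 'b \<Rightarrow> 'b"
  assumes zero_closed: "z \<in> E"
    and add_closed: "\<lbrakk>u \<in> E; v \<in> E\<rbrakk> \<Longrightarrow> u + v \<in> E"
    and scale_closed: "v \<in> E \<Longrightarrow> sc k v \<in> E"
    and add_assoc: "\<lbrakk>u \<in> E; v \<in> E; w \<in> E\<rbrakk> \<Longrightarrow> (u + v) + w = u + (v + w)"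
    and add_commute: "\<lbrakk>u \<in> E; v \<in> E\<rbrakk> \<Longrightarrow> u + v = v + u"
    and add_zero: "v \<in> E \<Longrightarrow> z + v = v"
    and diff_self: "v \<in> E \<Longrightarrow> v - v = z"
    and diff_eq: "\<lbrakk>u \<in> E; v \<in> E\<rbrakk> \<Longrightarrow> u - v = u + sc (- 1) v"
    and scale_one: "v \<in> E \<Longrightarrow> sc 1 v = v"
    and scale_scale: "v \<in> E \<Longrightarrow> sc k (sc l v) = sc (k * l) v"
    and scale_add_right: "\<lbrakk>u \<in> E; v \<in> E\<rbrakk> \<Longrightarrow> sc k (u + v) = sc k u + sc k v"
    and scale_add_left: "v \<in> E \<Longrightarrow> sc (k + l) v = sc k v + sc l v"

locale real_ordered_vector_space = real_vector_space_on E z sc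
  for E :: "'b::{plus,minus} set" and z :: 'b and sc :: "real \<Rightarrow> 'b \<Rightarrow> 'b" +
  fixes P :: "'b set"
  assumes cone_subset: "P \<subseteq> E"
    and cone_zero: "z \<in> P"
    and cone_add: "\<lbrakk>u \<in> P; v \<in> P\<rbrakk> \<Longrightarrow> u + v \<in> P"
    and cone_scale: "\<lbrakk>v \<in> P; 0 \<le> k\<rbrakk> \<Longrightarrow> sc k v \<in> P"

definition cone_le :: "'b::minus set \<Rightarrow> 'b \<Rightarrow> 'b \<Rightarrow> bool" where
  "cone_le P u v \<longleftrightarrow> v - u \<in> P"

locale absolutely_ordered_space = real_ordered_vector_space E z sc P
  for E :: "'b::{plus,minus} set" and z :: 'b and sc :: "real \<Rightarrow> 'b \<Rightarrow> 'b" and P :: "'b set" +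
  fixes ab :: "'b \<Rightarrow> 'b"
  assumes abs_in_cone: "v \<in> E \<Longrightarrow> ab v \<in> P"
    and abs_of_pos: "v \<in> P \<Longrightarrow> ab v = v"
    and abs_plus: "v \<in> E \<Longrightarrow> ab v + v \<in> P"
    and abs_minus: "v \<in> E \<Longrightarrow> ab v - v \<in> P"
    and abs_scale: "v \<in> E \<Longrightarrow> ab (sc k v) = sc \<bar>k\<bar> (ab v)"
    and abs_orth_mono: "\<lbrakk>u \<in> E; v \<in> E; w \<in> E; ab (u - v) = u + v; cone_le P z w; cone_le P w v\<rbrakk>
        \<Longrightarrow> ab (u - w) = u + w"
    and abs_orth_plus: "\<lbrakk>u \<in> E; v \<in> E; w \<in> E; ab (u - v) = u + v; ab (u - w) = u + w\<rbrakk>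
        \<Longrightarrow> ab (u - ab (v + w)) = u + ab (v + w)"
    and abs_orth_minus: "\<lbrakk>u \<in> E; v \<in> E; w \<in> E; ab (u - v) = u + v; ab (u - w) = u + w\<rbrakk>
        \<Longrightarrow> ab (u - ab (v - w)) = u + ab (v - w)"

definition orth :: "('b::{plus,minus} \<Rightarrow> 'b) \<Rightarrow> 'b \<Rightarrow> 'b \<Rightarrow> bool" where
  "orth ab u v \<longleftrightarrow> ab (u - v) = u + v"

section \<open>Matrices over a complex vector space with involution\<close>

locale star_vector_space = vector_space scale
  for scale :: "complex \<Rightarrow> 'v::ab_group_add \<Rightarrow> 'v" +
  fixes star :: "'v \<Rightarrow> 'v"
  assumes star_add: "star (x + y) = star x + star y"
    and star_scale: "star (scale c x) = scale (cnj c) (star x)"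
    and star_star: "star (star x) = x"

definition mat_lmul :: "(complex \<Rightarrow> 'v \<Rightarrow> 'v) \<Rightarrow> complex mat \<Rightarrow> 'v::ab_group_add mat \<Rightarrow> 'v mat" where
  "mat_lmul scale \<alpha> v =
     mat (dim_row \<alpha>) (dim_col v) (\<lambda>(i, j). \<Sum>k<dim_row v. scale (\<alpha> $$ (i, k)) (v $$ (k, j)))"

definition mat_rmul :: "(complex \<Rightarrow> 'v \<Rightarrow> 'v) \<Rightarrow> 'v::ab_group_add mat \<Rightarrow> complex mat \<Rightarrow> 'v mat" where
  "mat_rmul scale v \<beta> =
     mat (dim_row v) (dim_col \<beta>) (\<lambda>(i, j). \<Sum>k<dim_col v. scale (\<beta> $$ (k, j)) (v $$ (i, k)))"

definition mat_rscale :: "(complex \<Rightarrow> 'v \<Rightarrow> 'v) \<Rightarrow> real \<Rightarrow> 'v mat \<Rightarrow> 'v mat" where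
  "mat_rscale scale k v = map_mat (scale (complex_of_real k)) v"

definition mat_star :: "('v \<Rightarrow> 'v) \<Rightarrow> 'v mat \<Rightarrow> 'v mat" where
  "mat_star star v = map_mat star (transpose_mat v)"

definition mat_sa :: "('v \<Rightarrow> 'v) \<Rightarrow> nat \<Rightarrow> 'v mat set" where
  "mat_sa star n = {v \<in> carrier_mat n n. mat_star star v = v}"

definition mat_dsum :: "'v::zero mat \<Rightarrow> 'v mat \<Rightarrow> 'v mat" where
  "mat_dsum v w = four_block_mat v (0\<^sub>m (dim_row v) (dim_col w)) (0\<^sub>m (dim_row w) (dim_col v)) w"

definition mat_diag_n :: "'v::zero \<Rightarrow> nat \<Rightarrow> 'v mat" where
  "mat_diag_n e n = mat n n (\<lambda>(i, j). if i = j then e else 0)"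

definition cvec_norm :: "complex vec \<Rightarrow> real" where
  "cvec_norm x = L2_set (\<lambda>i. cmod (x $ i)) {..<dim_vec x}"

definition op_norm :: "complex mat \<Rightarrow> real" where
  "op_norm \<alpha> = Sup {cvec_norm (\<alpha> *\<^sub>v x) |x. x \<in> carrier_vec (dim_col \<alpha>) \<and> cvec_norm x \<le> 1}"

lemma (in star_vector_space) real_vector_space_on_mat_sa:
  "real_vector_space_on (mat_sa star n) (0\<^sub>m n n) (mat_rscale scale)"
proof -
  have star0: "star 0 = 0"
    using star_add[of 0 0] by simp
  have car: "v \<in> carrier_mat n n" if "v \<in> mat_sa star n" for v
    using that by (simp add: mat_sa_def)
  have dims: "dim_row v = n" "dim_col v = n" if "v \<in> mat_sa star n" for v
    using car[OF that] by auto
  have entry: "star (v $$ (j, i)) = v $$ (i, j)" if v: "v \<in> mat_sa star n" and "i < n" "j < n" for v i j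
  proof -
    have "mat_star star v = v" using v by (simp add: mat_sa_def)
    then have "mat_star star v $$ (i, j) = v $$ (i, j)" by simp
    then show ?thesis using car[OF v] that by (simp add: mat_star_def)
  qed
  have saI: "v \<in> mat_sa star n"
    if "v \<in> carrier_mat n n" "\<And>i j. i < n \<Longrightarrow> j < n \<Longrightarrow> star (v $$ (j, i)) = v $$ (i, j)" for v
    using that by (auto simp: mat_sa_def mat_star_def intro!: eq_matI)
  show ?thesis
    by unfold_locales
      (auto simp: mat_rscale_def dims entry star0 star_add star_scale algebra_simps
        dest: car intro!: saI eq_matI)
qed

section \<open>Matrix ordered spaces\<close>

text \<open>\<open>C n\<close> is the cone $M_n(V)^+$ and \<open>av m n\<close> is the map $|\cdot|_{m,n}$. Matrix sizes are
  positive throughout: nothing is assumed about \<open>C 0\<close>, \<open>av 0 n\<close> and \<open>av m 0\<close>. Likewise \<open>av m n\<close> is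
  only constrained on \<open>carrier_mat m n\<close>.\<close>

locale matrix_ordered_space = star_vector_space scale star
  for scale :: "complex \<Rightarrow> 'v::ab_group_add \<Rightarrow> 'v" and star :: "'v \<Rightarrow> 'v" +
  fixes C :: "nat \<Rightarrow> 'v mat set"
  assumes ordered: "0 < n \<Longrightarrow>
        real_ordered_vector_space (mat_sa star n) (0\<^sub>m n n) (mat_rscale scale) (C n)"
    and cone_compress: "\<lbrakk>0 < m; 0 < n; v \<in> C n; \<alpha> \<in> carrier_mat n m\<rbrakk> \<Longrightarrow>
        mat_rmul scale (mat_lmul scale (mat_adjoint \<alpha>) v) \<alpha> \<in> C m"

locale absolutely_matrix_ordered_space = matrix_ordered_space scale star C
  for scale :: "complex \<Rightarrow> 'v::ab_group_add \<Rightarrow> 'v" and star :: "'v \<Rightarrow> 'v"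
    and C :: "nat \<Rightarrow> 'v mat set" +
  fixes av :: "nat \<Rightarrow> nat \<Rightarrow> 'v mat \<Rightarrow> 'v mat"
  assumes av_in_cone: "\<lbrakk>0 < m; 0 < n; v \<in> carrier_mat m n\<rbrakk> \<Longrightarrow> av m n v \<in> C n"
    and av_abs: "0 < n \<Longrightarrow>
        absolutely_ordered_space (mat_sa star n) (0\<^sub>m n n) (mat_rscale scale) (C n) (av n n)"
    and av_mul: "\<lbrakk>0 < m; 0 < n; 0 < r; 0 < s;
          v \<in> carrier_mat m n; \<alpha> \<in> carrier_mat r m; \<beta> \<in> carrier_mat n s\<rbrakk> \<Longrightarrow>
        cone_le (C s)
          (av r s (mat_rmul scale (mat_lmul scale \<alpha> v) \<beta>))
          (mat_rscale scale (op_norm \<alpha>) (av n s (mat_rmul scale (av m n v) \<beta>)))"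
    and av_dsum: "\<lbrakk>0 < m; 0 < n; 0 < r; 0 < s; v \<in> carrier_mat m n; w \<in> carrier_mat r s\<rbrakk> \<Longrightarrow>
        av (m + r) (n + s) (mat_dsum v w) = mat_dsum (av m n v) (av r s w)"

section \<open>Absolute matrix order unit spaces\<close>

definition base_pos :: "(nat \<Rightarrow> 'v mat set) \<Rightarrow> 'v set" where
  "base_pos C = {v. mat 1 1 (\<lambda>_. v) \<in> C 1}"

locale matrix_order_unit_space = matrix_ordered_space scale star C
  for scale :: "complex \<Rightarrow> 'v::ab_group_add \<Rightarrow> 'v" and star :: "'v \<Rightarrow> 'v"
    and C :: "nat \<Rightarrow> 'v mat set" +
  fixes e :: 'v
  assumes unit_pos: "e \<in> base_pos C"
    and order_unit: "star x = x \<Longrightarrow> \<exists>k::real. k > 0 \<and>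
        scale (complex_of_real k) e + x \<in> base_pos C \<and>
        scale (complex_of_real k) e - x \<in> base_pos C"
    and proper: "base_pos C \<inter> uminus ` base_pos C = {0}"
    and archimedean: "\<lbrakk>0 < n; u \<in> mat_sa star n; v \<in> mat_sa star n;
        \<And>k::real. k > 0 \<Longrightarrow> v + mat_rscale scale k u \<in> C n\<rbrakk> \<Longrightarrow> v \<in> C n"

definition mat_norm ::
  "(complex \<Rightarrow> 'v \<Rightarrow> 'v) \<Rightarrow> ('v \<Rightarrow> 'v) \<Rightarrow> (nat \<Rightarrow> 'v mat set) \<Rightarrow> 'v::zero \<Rightarrow> nat \<Rightarrow> 'v mat \<Rightarrow> real" where
  "mat_norm scale star C e n v =
     Inf {k. k > 0 \<and>
       four_block_mat (mat_rscale scale k (mat_diag_n e n)) v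
         (mat_star star v) (mat_rscale scale k (mat_diag_n e n)) \<in> C (2 * n)}"

definition orth_inf ::
  "(complex \<Rightarrow> 'v \<Rightarrow> 'v) \<Rightarrow> ('v \<Rightarrow> 'v) \<Rightarrow> (nat \<Rightarrow> 'v mat set) \<Rightarrow> 'v::ab_group_add \<Rightarrow> nat
     \<Rightarrow> 'v mat \<Rightarrow> 'v mat \<Rightarrow> bool" where
  "orth_inf scale star C e n u v \<longleftrightarrow> (\<forall>k::real.
     mat_norm scale star C e n (u + mat_rscale scale k v) =
       max (mat_norm scale star C e n u) (mat_norm scale star C e n (mat_rscale scale k v)))"

definition abs_orth_inf ::
  "(complex \<Rightarrow> 'v \<Rightarrow> 'v) \<Rightarrow> ('v \<Rightarrow> 'v) \<Rightarrow> (nat \<Rightarrow> 'v mat set) \<Rightarrow> 'v::ab_group_add \<Rightarrow> nat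
     \<Rightarrow> 'v mat \<Rightarrow> 'v mat \<Rightarrow> bool" where
  "abs_orth_inf scale star C e n u v \<longleftrightarrow>
     (\<forall>u\<^sub>1\<in>mat_sa star n. \<forall>v\<^sub>1\<in>mat_sa star n.
        cone_le (C n) (0\<^sub>m n n) u\<^sub>1 \<and> cone_le (C n) u\<^sub>1 u \<and>
        cone_le (C n) (0\<^sub>m n n) v\<^sub>1 \<and> cone_le (C n) v\<^sub>1 v \<longrightarrow>
        orth_inf scale star C e n u\<^sub>1 v\<^sub>1)"

locale absolute_matrix_order_unit_space =
  absolutely_matrix_ordered_space scale star C av + matrix_order_unit_space scale star C e
  for scale :: "complex \<Rightarrow> 'v::ab_group_add \<Rightarrow> 'v" and star :: "'v \<Rightarrow> 'v"
    and C :: "nat \<Rightarrow> 'v mat set" and av :: "nat \<Rightarrow> nat \<Rightarrow> 'v mat \<Rightarrow> 'v mat" and e :: 'v +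
  assumes orth_iff: "\<lbrakk>0 < n; u \<in> C n; v \<in> C n\<rbrakk> \<Longrightarrow>
        orth (av n n) u v \<longleftrightarrow> abs_orth_inf scale star C e n u v"

section \<open>Order projections and partial isometries\<close>

definition OP ::
  "(complex \<Rightarrow> 'v \<Rightarrow> 'v) \<Rightarrow> ('v \<Rightarrow> 'v) \<Rightarrow> (nat \<Rightarrow> nat \<Rightarrow> 'v mat \<Rightarrow> 'v mat) \<Rightarrow> 'v::ab_group_add
     \<Rightarrow> nat \<Rightarrow> 'v mat set" where
  "OP scale star av e n =
     {p \<in> carrier_mat n n. mat_star star p = p \<and>
        av n n (mat_rscale scale 2 p - mat_diag_n e n) = mat_diag_n e n}"

definition OP_inf ::
  "(complex \<Rightarrow> 'v \<Rightarrow> 'v) \<Rightarrow> ('v \<Rightarrow> 'v) \<Rightarrow> (nat \<Rightarrow> nat \<Rightarrow> 'v mat \<Rightarrow> 'v mat) \<Rightarrow> 'v::ab_group_add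
     \<Rightarrow> 'v mat set" where
  "OP_inf scale star av e = (\<Union>n\<in>{0<..}. OP scale star av e n)"

definition PI ::
  "(complex \<Rightarrow> 'v \<Rightarrow> 'v) \<Rightarrow> ('v \<Rightarrow> 'v) \<Rightarrow> (nat \<Rightarrow> nat \<Rightarrow> 'v mat \<Rightarrow> 'v mat) \<Rightarrow> 'v::ab_group_add
     \<Rightarrow> nat \<Rightarrow> nat \<Rightarrow> 'v mat set" where
  "PI scale star av e m n =
     {v \<in> carrier_mat m n. av m n v \<in> OP scale star av e n \<and>
        av n m (mat_star star v) \<in> OP scale star av e m}"

definition pi_equivalence ::
  "(complex \<Rightarrow> 'v \<Rightarrow> 'v) \<Rightarrow> ('v \<Rightarrow> 'v) \<Rightarrow> (nat \<Rightarrow> nat \<Rightarrow> 'v mat \<Rightarrow> 'v mat) \<Rightarrow> 'v::ab_group_add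
     \<Rightarrow> ('v mat \<times> 'v mat) set" where
  "pi_equivalence scale star av e =
     {(p, q). \<exists>m>0. \<exists>n>0. p \<in> OP scale star av e m \<and> q \<in> OP scale star av e n \<and>
        (\<exists>v\<in>PI scale star av e m n. p = av n m (mat_star star v) \<and> q = av m n v)}"

definition condition_T ::
  "(complex \<Rightarrow> 'v \<Rightarrow> 'v) \<Rightarrow> ('v \<Rightarrow> 'v) \<Rightarrow> (nat \<Rightarrow> nat \<Rightarrow> 'v mat \<Rightarrow> 'v mat) \<Rightarrow> 'v::ab_group_add
     \<Rightarrow> bool" where
  "condition_T scale star av e \<longleftrightarrow>
     (\<forall>l>0. \<forall>m>0. \<forall>n>0. \<forall>u\<in>PI scale star av e m n. \<forall>v\<in>PI scale star av e l n.
        av m n u = av l n v \<longrightarrow>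
        (\<exists>w\<in>PI scale star av e m l.
           av l m (mat_star star w) = av n m (mat_star star u) \<and>
           av m l w = av n l (mat_star star v)))"

end

theory Submission
  imports Defs
begin

text \<open>Symmetry and transitivity are formal: the adjoint of a partial isometry is a partial isometry
  with the two absolute values interchanged, and if \<open>u\<close> implements \<open>p \<sim> q\<close> and \<open>v\<close> implements
  \<open>q \<sim> r\<close>, then \<open>u\<close> and \<open>v\<^sup>*\<close> have the same absolute value \<open>q\<close>, so that condition (T)
  produces a partial isometry implementing \<open>p \<sim> r\<close>. Only reflexivity uses the order structure: an
  order projection \<open>p\<close> is positive, because \<open>2p = |2p - e\<^sup>n| + (2p - e\<^sup>n)\<close>. Hence
  \<open>|p| = p = |p\<^sup>*|\<close>, and \<open>p\<close> itself is a partial isometry implementing \<open>p \<sim> p\<close>.\<close>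

lemma (in star_vector_space) mat_star_mat_star: "mat_star star (mat_star star v) = v"
  by (rule eq_matI) (auto simp: mat_star_def star_star)

lemma mat_star_carrier: "v \<in> carrier_mat m n \<Longrightarrow> mat_star star v \<in> carrier_mat n m"
  by (auto simp: mat_star_def)

context absolute_matrix_order_unit_space
begin

lemma star_unit: "star e = e"
proof -
  interpret o1: real_ordered_vector_space "mat_sa star 1" "0\<^sub>m 1 1" "mat_rscale scale" "C 1"
    by (rule ordered) simp
  have "mat_star star (mat 1 1 (\<lambda>_. e)) = mat 1 1 (\<lambda>_. e)"
    using unit_pos o1.cone_subset by (auto simp: base_pos_def mat_sa_def)
  then have "mat_star star (mat 1 1 (\<lambda>_. e)) $$ (0, 0) = mat 1 1 (\<lambda>_. e) $$ (0, 0)"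
    by (rule arg_cong)
  then show ?thesis
    by (simp add: mat_star_def)
qed

lemma unit_matrix_sa: "mat_diag_n e n \<in> mat_sa star n"
proof -
  have "star 0 = 0"
    using star_add[of 0 0] by simp
  then show ?thesis
    by (auto simp: mat_sa_def mat_star_def mat_diag_n_def star_unit intro!: eq_matI)
qed

lemma OP_sa: "p \<in> OP scale star av e n \<Longrightarrow> p \<in> mat_sa star n"
  by (simp add: OP_def mat_sa_def)

lemma OP_positive:
  assumes "0 < n" and p: "p \<in> OP scale star av e n"
  shows "p \<in> C n"
proof -
  interpret a: absolutely_ordered_space "mat_sa star n" "0\<^sub>m n n" "mat_rscale scale" "C n" "av n n"
    using \<open>0 < n\<close> by (rule av_abs)
  let ?d = "mat_rscale scale 2 p - mat_diag_n e n"
  have car: "p \<in> carrier_mat n n" and abs: "av n n ?d = mat_diag_n e n"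
    using p by (auto simp: OP_def)
  have "?d \<in> mat_sa star n"
    by (simp add: a.diff_eq a.add_closed a.scale_closed OP_sa[OF p] unit_matrix_sa)
  then have "mat_diag_n e n + ?d \<in> C n"
    using a.abs_plus[of ?d] by (simp only: abs)
  moreover have "mat_diag_n e n + ?d = mat_rscale scale 2 p"
    using car by (auto simp: mat_diag_n_def mat_rscale_def intro!: eq_matI)
  ultimately have "mat_rscale scale (1 / 2) (mat_rscale scale 2 p) \<in> C n"
    using a.cone_scale[of _ "1 / 2"] by simp
  then show ?thesis
    using a.scale_scale a.scale_one OP_sa[OF p] by simp
qed

lemma av_OP: "\<lbrakk>0 < n; p \<in> OP scale star av e n\<rbrakk> \<Longrightarrow> av n n p = p"
  using absolutely_ordered_space.abs_of_pos[OF av_abs] OP_positive by blast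

lemma OP_imp_PI: "\<lbrakk>0 < n; p \<in> OP scale star av e n\<rbrakk> \<Longrightarrow> p \<in> PI scale star av e n n"
  using av_OP[of n p] by (auto simp: PI_def OP_def)

lemma PI_star: "v \<in> PI scale star av e m n \<Longrightarrow> mat_star star v \<in> PI scale star av e n m"
  by (simp add: PI_def mat_star_carrier mat_star_mat_star)

text \<open>The membership of \<open>p\<close> and \<open>q\<close> in the sets of order projections is implied by that of \<open>v\<close> in
  the set of partial isometries.\<close>

lemma pi_equivalence_iff:
  "(p, q) \<in> pi_equivalence scale star av e \<longleftrightarrow>
    (\<exists>m>0. \<exists>n>0. \<exists>v\<in>PI scale star av e m n. p = av n m (mat_star star v) \<and> q = av m n v)"
  unfolding pi_equivalence_def PI_def by blast

lemma pi_equivalence_subset: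
  "pi_equivalence scale star av e \<subseteq> OP_inf scale star av e \<times> OP_inf scale star av e"
  by (auto simp: pi_equivalence_def OP_inf_def)

lemma refl_on_pi_equivalence: "refl_on (OP_inf scale star av e) (pi_equivalence scale star av e)"
proof (rule refl_onI)
  fix p assume "p \<in> OP_inf scale star av e"
  then obtain n where n: "0 < n" and p: "p \<in> OP scale star av e n"
    by (auto simp: OP_inf_def)
  have "p = av n n (mat_star star p)" "p = av n n p"
    using p av_OP[OF n p] by (simp_all add: OP_def)
  with n OP_imp_PI[OF n p] show "(p, p) \<in> pi_equivalence scale star av e"
    unfolding pi_equivalence_iff by blast
qed

lemma sym_pi_equivalence: "sym (pi_equivalence scale star av e)"
proof (rule symI)
  fix p q assume "(p, q) \<in> pi_equivalence scale star av e"
  then obtain m n v where "0 < m" "0 < n" and v: "v \<in> PI scale star av e m n"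
    and "p = av n m (mat_star star v)" "q = av m n v"
    unfolding pi_equivalence_iff by blast
  moreover from this have "q = av m n (mat_star star (mat_star star v))"
    by (simp add: mat_star_mat_star)
  ultimately show "(q, p) \<in> pi_equivalence scale star av e"
    unfolding pi_equivalence_iff using PI_star[OF v] by blast
qed

lemma trans_pi_equivalence:
  assumes T: "condition_T scale star av e"
  shows "trans (pi_equivalence scale star av e)"
proof (rule transI)
  fix p q r
  assume "(p, q) \<in> pi_equivalence scale star av e" and "(q, r) \<in> pi_equivalence scale star av e"
  then obtain m n k l u v
    where pos: "0 < m" "0 < n" "0 < k" "0 < l"
      and u: "u \<in> PI scale star av e m n" "p = av n m (mat_star star u)" "q = av m n u"
      and v: "v \<in> PI scale star av e k l" "q = av l k (mat_star star v)" "r = av k l v"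
    unfolding pi_equivalence_iff by blast
  \<comment> \<open>An element of \<open>OP_inf\<close> determines its size, so the middle sizes of \<open>u\<close> and \<open>v\<close> agree.\<close>
  have "q \<in> carrier_mat n n" "q \<in> carrier_mat k k"
    using u v by (auto simp: PI_def OP_def)
  then have "k = n"
    by auto
  then have "mat_star star v \<in> PI scale star av e l n" "av m n u = av l n (mat_star star v)"
    using u v PI_star by auto
  with T pos u(1) obtain w where w: "w \<in> PI scale star av e m l"
    "av l m (mat_star star w) = av n m (mat_star star u)"
    "av m l w = av n l (mat_star star (mat_star star v))"
    unfolding condition_T_def by blast
  then have "p = av l m (mat_star star w)" "r = av m l w"
    using u v \<open>k = n\<close> by (simp_all add: mat_star_mat_star)
  with pos w(1) show "(p, r) \<in> pi_equivalence scale star av e"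
    unfolding pi_equivalence_iff by blast
qed

end

theorem proposition4p4:
  fixes scale :: "complex \<Rightarrow> 'v::ab_group_add \<Rightarrow> 'v"
    and star :: "'v \<Rightarrow> 'v"
    and C :: "nat \<Rightarrow> 'v mat set"
    and av :: "nat \<Rightarrow> nat \<Rightarrow> 'v mat \<Rightarrow> 'v mat"
    and e :: 'v
  assumes "absolute_matrix_order_unit_space scale star C av e"
    and "condition_T scale star av e"
  shows "equiv (OP_inf scale star av e) (pi_equivalence scale star av e)"
proof -
  interpret absolute_matrix_order_unit_space scale star C av e
    by (fact assms(1))
  show ?thesis
    using pi_equivalence_subset refl_on_pi_equivalence sym_pi_equivalence
      trans_pi_equivalence[OF assms(2)]
    by (rule equivI)
qed

end
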